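(* Let $n,k\in\mathbb{Z}^+$, let $p_j$ denote the $j$-th prime, $P_{k,n}=\{p_n,\dots,p_{n+k-1}\}$ and $N=p_n p_{n+1}\cdots p_{n+k-1}$. Define the unary promise problem $\mathtt{L^{k,n}}=(\mathtt{L^{k,n}_{yes}},\mathtt{L^{k,n}_{no}})$ by $\mathtt{L^{k,n}_{yes}}=\{a^m\mid m\equiv 0\pmod N\}$ and $\mathtt{L^{k,n}_{no}}=\{a^m\mid m\bmod p_j\in[\frac{p_j}{8},\frac{3p_j}{8}]\cup[\frac{5p_j}{8},\frac{7p_j}{8}]\text{ for at least }\frac{2k}{3}\text{ different }p_j\in P_{k,n}\}$. Then $\mathtt{L^{k,n}}$ is solvable by a $2k$-state Moore–Crutchfield QFA that accepts every yes-instance with probability $1$ and rejects every no-instance with probability at least $\frac13$.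
   Context: A Moore–Crutchfield QFA is $(Q,\Sigma,\{U_\sigma\}_{\sigma\in\Sigma},|v_0\rangle,Q_a)$ with finite state set $Q$, unitary matrices $U_\sigma$, unit-norm complex initial vector $|v_0\rangle$ and accepting set $Q_a$; on input $w=w_1\cdots w_\ell$ the final vector is $|v_\ell\rangle=U_{w_\ell}\cdots U_{w_1}|v_0\rangle$ and the acceptance probability is $\sum_{q_j\in Q_a}|\,|v_\ell\rangle(j)|^2$; the rejection probability is one minus this. *)

theory Defs
  imports
    "HOL-Library.Infinite_Set"
    "HOL-Computational_Algebra.Primes"
    "HOL-Number_Theory.Cong"
    "Jordan_Normal_Form.Schur_Decomposition"
begin

text \<open>The states are the indices below \<open>num_states\<close>, so that state vectors and
  transition matrices are indexed directly by states.\<close>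

record 'a qfa =
  num_states :: nat
  alphabet :: "'a set"
  trans_mat :: "'a \<Rightarrow> complex mat"
  init_vec :: "complex vec"
  acc_states :: "nat set"

definition unitary_mat :: "complex mat \<Rightarrow> bool" where
  "unitary_mat U \<longleftrightarrow>
     square_mat U \<and> inverts_mat U (mat_adjoint U) \<and> inverts_mat (mat_adjoint U) U"

definition l2_norm_vec :: "complex vec \<Rightarrow> real" where
  "l2_norm_vec v = sqrt (\<Sum>j<dim_vec v. (cmod (v $ j))\<^sup>2)"

definition mc_qfa :: "'a qfa \<Rightarrow> bool" where
  "mc_qfa M \<longleftrightarrow>
     finite (alphabet M) \<and>
     (\<forall>\<sigma> \<in> alphabet M.
        trans_mat M \<sigma> \<in> carrier_mat (num_states M) (num_states M) \<and>
        unitary_mat (trans_mat M \<sigma>)) \<and>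
     init_vec M \<in> carrier_vec (num_states M) \<and>
     l2_norm_vec (init_vec M) = 1 \<and>
     acc_states M \<subseteq> {..<num_states M}"

definition final_vec :: "'a qfa \<Rightarrow> 'a list \<Rightarrow> complex vec" where
  "final_vec M w = foldl (\<lambda>v \<sigma>. trans_mat M \<sigma> *\<^sub>v v) (init_vec M) w"

definition acc_prob :: "'a qfa \<Rightarrow> 'a list \<Rightarrow> real" where
  "acc_prob M w = (\<Sum>j\<in>acc_states M. (cmod (final_vec M w $ j))\<^sup>2)"

definition rej_prob :: "'a qfa \<Rightarrow> 'a list \<Rightarrow> real" where
  "rej_prob M w = 1 - acc_prob M w"


text \<open>Numbered from 1: \<open>nth_prime 1 = 2\<close>. Since \<open>enumerate\<close> starts at 0, the index is
  shifted; the value at 0 is junk and is never used below for positive \<open>n\<close>.\<close>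

definition nth_prime :: "nat \<Rightarrow> nat" where
  "nth_prime j = enumerate {p. prime p} (j - 1)"

definition prime_block :: "nat \<Rightarrow> nat \<Rightarrow> nat set" where
  "prime_block k n = nth_prime ` {n..n + k - 1}"

definition block_prod :: "nat \<Rightarrow> nat \<Rightarrow> nat" where
  "block_prod k n = (\<Prod>j = n..n + k - 1. nth_prime j)"

definition L_yes :: "'a \<Rightarrow> nat \<Rightarrow> nat \<Rightarrow> 'a list set" where
  "L_yes a k n = {replicate m a | m. [m = 0] (mod block_prod k n)}"

definition L_no :: "'a \<Rightarrow> nat \<Rightarrow> nat \<Rightarrow> 'a list set" where
  "L_no a k n = {replicate m a | m.
     2 * real k / 3 \<le>
       real (card {p \<in> prime_block k n.
         real (m mod p) \<in> {real p / 8..3 * real p / 8} \<union> {5 * real p / 8..7 * real p / 8}})}"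

lemma L_yes_no_disjoint:
  assumes "k > 0"
  shows "L_yes a k n \<inter> L_no a k n = {}"
proof (rule ccontr)
  assume "L_yes a k n \<inter> L_no a k n \<noteq> {}"
  then obtain w where "w \<in> L_yes a k n" and wno: "w \<in> L_no a k n" by blast
  then obtain m where w: "w = replicate m a" and m: "block_prod k n dvd m"
    by (auto simp: L_yes_def cong_0_iff)
  from wno w have c: "2 * real k / 3 \<le>
       real (card {p \<in> prime_block k n.
         real (m mod p) \<in> {real p / 8..3 * real p / 8} \<union> {5 * real p / 8..7 * real p / 8}})"
    by (auto simp: L_no_def dest: arg_cong[where f = length])
  have "real (m mod p) \<notin> {real p / 8..3 * real p / 8} \<union> {5 * real p / 8..7 * real p / 8}"
    if p: "p \<in> prime_block k n" for p
  proof -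
    from p obtain j where j: "j \<in> {n..n + k - 1}" "p = nth_prime j"
      by (auto simp: prime_block_def)
    have "p \<in> {p. prime p}"
      unfolding j nth_prime_def using primes_infinite by (rule enumerate_in_set)
    then have "p > 0" by (simp add: prime_gt_0_nat)
    moreover have "p dvd block_prod k n"
      unfolding block_prod_def j(2) using j(1) by (intro dvd_prodI) auto
    then have "m mod p = 0" using m by (metis dvd_trans dvd_imp_mod_0)
    ultimately show ?thesis by simp
  qed
  then have "{p \<in> prime_block k n.
      real (m mod p) \<in> {real p / 8..3 * real p / 8} \<union> {5 * real p / 8..7 * real p / 8}} = {}"
    by blast
  with c have "2 * real k / 3 \<le> 0" by (metis card.empty of_nat_0)
  with assms show False by simp
qed

end

theory Submission
  imports Defs
begin

text \<open>The automaton consists of \<open>k\<close> two-dimensional rotations, the one for the prime \<open>p\<close> by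
  the angle \<open>2 * pi / p\<close>, started in the uniform superposition of the cosine states. It accepts
  \<open>a\<^sup>m\<close> with the probability that is the average of \<open>(cos (2 * pi * m / p))\<^sup>2\<close> over the block. On
  a no-instance at least two thirds of these terms are at most \<open>1/2\<close>, so that the average is at
  most \<open>1 - (2/3) * (1/2) = 2/3\<close>.\<close>

lemma mat_diag_add:
  fixes f g :: "nat \<Rightarrow> 'a :: monoid_add"
  shows "mat_diag k f + mat_diag k g = mat_diag k (\<lambda>i. f i + g i)"
  by (rule eq_matI) (auto simp: mat_diag_def)

lemma mat_diag_mult_vec:
  fixes f :: "nat \<Rightarrow> 'a :: semiring_0"
  shows "mat_diag k f *\<^sub>v vec k g = vec k (\<lambda>i. f i * g i)"
proof (rule eq_vecI)
  fix i assume "i < dim_vec (vec k (\<lambda>i. f i * g i))"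
  then have i: "i < k" by simp
  have "(mat_diag k f *\<^sub>v vec k g) $ i = (\<Sum>j\<in>{0..<k}. (if i = j then f j else 0) * g j)"
    using i by (simp add: mat_diag_def scalar_prod_def)
  also have "\<dots> = (\<Sum>j\<in>{0..<k}. if i = j then f j * g j else 0)"
    by (intro sum.cong) auto
  finally show "(mat_diag k f *\<^sub>v vec k g) $ i = vec k (\<lambda>i. f i * g i) $ i"
    using i by simp
qed (simp add: mat_diag_def)

text \<open>The plane of the \<open>i\<close>-th rotation is spanned by the states \<open>i\<close> (cosine) and \<open>k + i\<close> (sine).\<close>

definition rot_mat :: "nat \<Rightarrow> (nat \<Rightarrow> real) \<Rightarrow> complex mat" where
  "rot_mat k \<theta> = four_block_mat
     (mat_diag k (\<lambda>i. of_real (cos (\<theta> i)))) (mat_diag k (\<lambda>i. of_real (- sin (\<theta> i))))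
     (mat_diag k (\<lambda>i. of_real (sin (\<theta> i)))) (mat_diag k (\<lambda>i. of_real (cos (\<theta> i))))"

text \<open>With all angles 0 this is the uniform superposition of the cosine states; other angles
  describe the states reached from it. The factor \<open>1 / sqrt (real k)\<close> gives each plane
  weight \<open>1 / k\<close>.\<close>

definition rot_vec :: "nat \<Rightarrow> (nat \<Rightarrow> real) \<Rightarrow> complex vec" where
  "rot_vec k \<theta> = vec k (\<lambda>i. of_real (cos (\<theta> i) / sqrt (real k))) @\<^sub>v
                  vec k (\<lambda>i. of_real (sin (\<theta> i) / sqrt (real k)))"

lemma rot_mat_carrier [simp]: "rot_mat k \<theta> \<in> carrier_mat (2 * k) (2 * k)"
  unfolding rot_mat_def mult_2 by (intro four_block_carrier_mat mat_diag_dim)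

lemma rot_vec_carrier [simp]: "rot_vec k \<theta> \<in> carrier_vec (2 * k)"
  unfolding rot_vec_def mult_2 by (intro append_carrier_vec vec_carrier)

lemma rot_mat_mult: "rot_mat k \<theta> * rot_mat k \<phi> = rot_mat k (\<lambda>i. \<theta> i + \<phi> i)"
  unfolding rot_mat_def
  by (subst mult_four_block_mat[OF mat_diag_dim mat_diag_dim mat_diag_dim mat_diag_dim
        mat_diag_dim mat_diag_dim mat_diag_dim mat_diag_dim])
    (simp add: mat_diag_add cos_add sin_add algebra_simps)

lemma rot_mat_0: "rot_mat k (\<lambda>_. 0) = 1\<^sub>m (2 * k)"
proof -
  have "mat_diag k (\<lambda>_. 0) = (0\<^sub>m k k :: complex mat)"
    by (rule eq_matI) (auto simp: mat_diag_def)
  then show ?thesis by (simp add: rot_mat_def mult_2)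
qed

text \<open>The entries are real and the blocks diagonal, so the adjoint just exchanges the two sine
  blocks, which amounts to negating the angles. With \<open>rot_mat_mult\<close> this yields
  unitarity.\<close>

lemma mat_adjoint_rot_mat: "mat_adjoint (rot_mat k \<theta>) = rot_mat k (\<lambda>i. - \<theta> i)"
  by (rule eq_matI) (auto simp: mat_adjoint_def rot_mat_def mat_diag_def mat_of_rows_index)

lemma unitary_rot_mat: "unitary_mat (rot_mat k \<theta>)"
  by (simp add: carrier_matD[OF rot_mat_carrier] unitary_mat_def inverts_mat_def
      mat_adjoint_rot_mat rot_mat_mult rot_mat_0)

lemma rot_mat_mult_vec: "rot_mat k \<theta> *\<^sub>v rot_vec k \<phi> = rot_vec k (\<lambda>i. \<theta> i + \<phi> i)"
proof -
  have vec_add: "vec k f + vec k g = vec k (\<lambda>i. f i + g i)" for f g :: "nat \<Rightarrow> complex"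
    by (rule eq_vecI) auto
  show ?thesis
    unfolding rot_mat_def rot_vec_def
    by (subst four_block_mat_mult_vec[OF mat_diag_dim mat_diag_dim mat_diag_dim mat_diag_dim
          vec_carrier vec_carrier])
      (simp add: mat_diag_mult_vec vec_add cos_add sin_add add_divide_distrib diff_divide_distrib
        add.commute mult.commute)
qed

lemma l2_norm_rot_vec:
  assumes "k > 0"
  shows "l2_norm_vec (rot_vec k \<theta>) = 1"
proof -
  have split: "(\<Sum>j<k + l. f j) = (\<Sum>j<k. f j) + (\<Sum>j<l. f (k + j))"
    for l and f :: "nat \<Rightarrow> real"
    by (induction l) (simp_all add: add.assoc)
  have "(\<Sum>j<2 * k. (cmod (rot_vec k \<theta> $ j))\<^sup>2)
      = (\<Sum>j<k. (cmod (rot_vec k \<theta> $ j))\<^sup>2) + (\<Sum>j<k. (cmod (rot_vec k \<theta> $ (k + j)))\<^sup>2)"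
    unfolding mult_2 by (rule split)
  also have "\<dots> = (\<Sum>j<k. (cos (\<theta> j))\<^sup>2 / k) + (\<Sum>j<k. (sin (\<theta> j))\<^sup>2 / k)"
    using assms by (simp add: rot_vec_def norm_divide power_divide)
  also have "\<dots> = (\<Sum>j<k. 1 / k)"
    by (simp flip: sum.distrib add_divide_distrib)
  also have "\<dots> = 1" using assms by simp
  finally show ?thesis
    by (simp add: l2_norm_vec_def carrier_vecD[OF rot_vec_carrier])
qed

definition rot_qfa :: "'a \<Rightarrow> nat \<Rightarrow> (nat \<Rightarrow> real) \<Rightarrow> 'a qfa" where
  "rot_qfa a k \<theta> = \<lparr>num_states = 2 * k, alphabet = {a}, trans_mat = (\<lambda>_. rot_mat k \<theta>),
     init_vec = rot_vec k (\<lambda>_. 0), acc_states = {..<k}\<rparr>"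

lemma mc_qfa_rot_qfa: "k > 0 \<Longrightarrow> mc_qfa (rot_qfa a k \<theta>)"
  by (auto simp: mc_qfa_def rot_qfa_def unitary_rot_mat l2_norm_rot_vec)

lemma final_vec_rot_qfa:
  "final_vec (rot_qfa a k \<theta>) (replicate m a) = rot_vec k (\<lambda>i. real m * \<theta> i)"
proof -
  \<comment> \<open>The start angles are generalised because \<open>foldl\<close> changes the start
    vector with every letter read.\<close>
  have "foldl (\<lambda>v \<sigma>. rot_mat k \<theta> *\<^sub>v v) (rot_vec k \<phi>) (replicate m a)
      = rot_vec k (\<lambda>i. real m * \<theta> i + \<phi> i)" for \<phi>
    by (induction m arbitrary: \<phi>) (simp_all add: rot_mat_mult_vec algebra_simps)
  from this[of "\<lambda>_. 0"] show ?thesis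
    by (simp add: final_vec_def rot_qfa_def)
qed

lemma acc_prob_rot_qfa:
  "acc_prob (rot_qfa a k \<theta>) (replicate m a) = (\<Sum>i<k. (cos (real m * \<theta> i))\<^sup>2) / real k"
proof -
  have "acc_prob (rot_qfa a k \<theta>) (replicate m a)
      = (\<Sum>i<k. (cmod (rot_vec k (\<lambda>i. real m * \<theta> i) $ i))\<^sup>2)"
    unfolding acc_prob_def final_vec_rot_qfa by (simp add: rot_qfa_def)
  also have "\<dots> = (\<Sum>i<k. (cos (real m * \<theta> i))\<^sup>2 / real k)"
    by (intro sum.cong) (auto simp: rot_vec_def norm_divide power_divide)
  finally show ?thesis by (simp add: sum_divide_distrib)
qed

text \<open>Shifting by \<open>pi\<close> negates the cosine and moves the argument into the
  interval from \<open>- pi / 2\<close> to \<open>pi / 2\<close>.\<close>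

lemma cos_nonpos:
  fixes x :: real
  assumes "pi / 2 \<le> x" "x \<le> 3 * pi / 2"
  shows "cos x \<le> 0"
  using cos_ge_zero[of "x - pi"] cos_periodic_pi[of "x - pi"] assms by simp

text \<open>The doubled angle \<open>4 * pi * m / p\<close> lies, modulo \<open>2 * pi\<close>, between \<open>pi / 2\<close> and
  \<open>3 * pi / 2\<close>.\<close>

lemma cos_square_le_half:
  fixes m p :: nat
  assumes p: "p > 0"
    and m: "real (m mod p) \<in> {real p / 8..3 * real p / 8} \<union> {5 * real p / 8..7 * real p / 8}"
  shows "(cos (real m * (2 * pi / real p)))\<^sup>2 \<le> 1 / 2"
proof -
  define x where "x = real (m mod p) / real p"
  have x: "1 / 8 \<le> x \<and> x \<le> 3 / 8 \<or> 5 / 8 \<le> x \<and> x \<le> 7 / 8"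
    using m p by (auto simp: x_def field_simps)
  have "real m = real (m div p) * real p + real (m mod p)"
    by (metis div_mult_mod_eq of_nat_add of_nat_mult)
  \<comment> \<open>The full turns are written in the shape required by \<open>cos_2npi\<close> and
    \<open>sin_2npi\<close>.\<close>
  then have "2 * (real m * (2 * pi / real p)) = 4 * pi * x + 2 * real (2 * (m div p)) * pi"
    using p by (simp add: x_def field_simps)
  then have "cos (2 * (real m * (2 * pi / real p))) = cos (4 * pi * x)"
    by (simp only: cos_add cos_2npi sin_2npi)
  also have "\<dots> \<le> 0"
    using x
  proof
    assume "1 / 8 \<le> x \<and> x \<le> 3 / 8"
    then have "pi / 2 \<le> 4 * pi * x" "4 * pi * x \<le> 3 * pi / 2"
      by auto
    then show ?thesis by (rule cos_nonpos)
  next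
    assume "5 / 8 \<le> x \<and> x \<le> 7 / 8"
    \<comment> \<open>Here the doubled angle lies between \<open>5 * pi / 2\<close> and
      \<open>7 * pi / 2\<close>, one full turn too far for \<open>cos_nonpos\<close>.\<close>
    then have "pi * (5 / 8) \<le> pi * x" "pi * x \<le> pi * (7 / 8)"
      by auto
    then have "cos (4 * pi * x - 2 * pi) \<le> 0"
      by (intro cos_nonpos) auto
    then show ?thesis using cos_periodic[of "4 * pi * x - 2 * pi"] by simp
  qed
  \<comment> \<open>The cosine of the doubled angle is twice the squared cosine minus 1, so its
    being nonpositive is the claimed bound.\<close>
  finally show ?thesis unfolding cos_double_cos by simp
qed

lemma cos_square_eq_1:
  fixes m p :: nat
  assumes "p > 0" "p dvd m"
  shows "(cos (real m * (2 * pi / real p)))\<^sup>2 = 1"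
proof -
  from assms(2) obtain q where "m = p * q" by blast
  then have "real m * (2 * pi / real p) = 2 * real q * pi"
    using assms(1) by simp
  then show ?thesis by (simp only: cos_2npi) simp
qed

lemma nth_prime_pos: "nth_prime j > 0"
  using enumerate_in_set[OF primes_infinite, of "j - 1"]
  by (simp add: nth_prime_def prime_gt_0_nat)

text \<open>Index 0 is excluded: by truncated subtraction \<open>nth_prime 0\<close> equals
  \<open>nth_prime 1\<close>.\<close>

lemma inj_on_nth_prime: "inj_on nth_prime {0<..}"
proof (rule inj_onI)
  fix i j :: nat
  assume "i \<in> {0<..}" "j \<in> {0<..}" "nth_prime i = nth_prime j"
  then show "i = j"
    by (auto simp: nth_prime_def inj_eq[OF inj_enumerate[OF primes_infinite]])
qed

text \<open>\<open>L_no\<close> counts primes, whereas the acceptance probability is a sum over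
  indices; injectivity of \<open>nth_prime\<close> makes the two counts agree.\<close>

lemma card_prime_block_filter:
  assumes "n > 0" "k > 0"
  shows "card {p \<in> prime_block k n. P p} = card {i \<in> {..<k}. P (nth_prime (n + i))}"
proof -
  have ivl: "{n..n + k - 1} = (+) n ` {..<k}"
    using assms by (simp add: lessThan_atLeast0 add.commute
        flip: atLeastLessThanSuc_atLeastAtMost)
  then have "{p \<in> prime_block k n. P p}
      = (\<lambda>i. nth_prime (n + i)) ` {i \<in> {..<k}. P (nth_prime (n + i))}"
    by (auto simp: prime_block_def)
  moreover have "inj_on (\<lambda>i. nth_prime (n + i)) {i \<in> {..<k}. P (nth_prime (n + i))}"
    using assms by (auto intro!: inj_onI dest: inj_onD[OF inj_on_nth_prime])
  ultimately show ?thesis by (simp add: card_image)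
qed

text \<open>Each index satisfying \<open>P\<close> lowers the trivial bound by 1/2. It is applied to
  the squared cosines, with \<open>P\<close> selecting the primes that witness a
  no-instance.\<close>

lemma sum_le_card_half:
  fixes f :: "'b \<Rightarrow> real"
  assumes "finite A" "\<And>i. i \<in> A \<Longrightarrow> f i \<le> 1" "\<And>i. i \<in> A \<Longrightarrow> P i \<Longrightarrow> f i \<le> 1 / 2"
  shows "(\<Sum>i\<in>A. f i) \<le> real (card A) - real (card {i \<in> A. P i}) / 2"
proof -
  have "(\<Sum>i\<in>A. f i) \<le> (\<Sum>i\<in>A. 1 - (if P i then 1 / 2 else 0))"
    using assms(2,3) by (intro sum_mono) auto
  also have "\<dots> = real (card A) - real (card {i \<in> A. P i}) / 2"
    using assms(1) by (simp add: sum_subtractf flip: sum.inter_filter)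
  finally show ?thesis .
qed

theorem theorem6:
  fixes a :: 'a and n k :: nat
  assumes "n > 0" and "k > 0"
  shows "\<exists>M :: 'a qfa. mc_qfa M \<and> alphabet M = {a} \<and> num_states M = 2 * k \<and>
           (\<forall>w \<in> L_yes a k n. acc_prob M w = 1) \<and>
           (\<forall>w \<in> L_no a k n. rej_prob M w \<ge> 1 / 3)"
proof -
  define \<theta> where "\<theta> i = 2 * pi / real (nth_prime (n + i))" for i
  define M where "M = rot_qfa a k \<theta>"
  have "acc_prob M w = 1" if yes: "w \<in> L_yes a k n" for w
  proof -
    from yes obtain m where w: "w = replicate m a" and m: "block_prod k n dvd m"
      by (auto simp: L_yes_def cong_0_iff)
    \<comment> \<open>Every prime of the block divides \<open>m\<close>, so each plane has made a
      whole number of turns.\<close>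
    have "(cos (real m * \<theta> i))\<^sup>2 = 1" if "i < k" for i
    proof -
      have "nth_prime (n + i) dvd block_prod k n"
        unfolding block_prod_def using that by (intro dvd_prodI) auto
      then show ?thesis
        unfolding \<theta>_def using m by (intro cos_square_eq_1 nth_prime_pos) (rule dvd_trans)
    qed
    then show ?thesis
      using \<open>k > 0\<close> by (simp add: M_def w acc_prob_rot_qfa)
  qed
  moreover have "rej_prob M w \<ge> 1 / 3" if no: "w \<in> L_no a k n" for w
  proof -
    define mid where "mid m p \<longleftrightarrow>
      real (m mod p) \<in> {real p / 8..3 * real p / 8} \<union> {5 * real p / 8..7 * real p / 8}"
      for m p :: nat
    from no obtain m where w: "w = replicate m a"
      and m: "2 * real k / 3 \<le> real (card {p \<in> prime_block k n. mid m p})"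
      unfolding L_no_def mid_def by blast
    have "(\<Sum>i<k. (cos (real m * \<theta> i))\<^sup>2)
        \<le> real (card {..<k}) - real (card {i \<in> {..<k}. mid m (nth_prime (n + i))}) / 2"
      unfolding \<theta>_def mid_def
      by (intro sum_le_card_half cos_square_le_half nth_prime_pos) (auto simp: abs_square_le_1)
    \<comment> \<open>At least \<open>2 * k / 3\<close> indices lose 1/2 each, a total loss of at
      least \<open>k / 3\<close>.\<close>
    also have "\<dots> \<le> 2 / 3 * real k"
      using m assms by (simp add: card_prime_block_filter)
    finally have "acc_prob M w \<le> 2 / 3"
      using \<open>k > 0\<close> by (simp add: M_def w acc_prob_rot_qfa divide_le_eq)
    then show ?thesis by (simp add: rej_prob_def)
  qed
  moreover have "mc_qfa M" "alphabet M = {a}" "num_states M = 2 * k"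
    using \<open>k > 0\<close> by (simp_all add: M_def mc_qfa_rot_qfa) (simp_all add: rot_qfa_def)
  ultimately show ?thesis by blast
qed

end
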